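(* Let $\mathcal M$ be a nonempty finite workflow pool. Suppose the recovery curves are generated by a common increasing concave function $h:[0,1]\to[0,1]$ with $h(0)=0$, so that $\psi_k(r)=h(r/k)$ for $r=0,\dots,k$ and $k=1,\dots,K_{\max}$. Let $\mathrm{OPT}_k^+(\mathcal M)=\max\{0,\mathrm{OPT}_k(\mathcal M)\}$. Then, for every $1\le b\le k\le K_{\max}$, $$\mathrm{OPT}_b^+(\mathcal M)\ge\frac bk\,\mathrm{OPT}_k^+(\mathcal M).$$ Consequently, if a cardinality grid $\mathcal K\subseteq\{1,\dots,K_{\max}\}$ has coverage ratio $\varrho\ge1$, meaning that for every $k\in\{1,\dots,K_{\max}\}$ there exists $b\in\mathcal K$ with $b\le k\le\varrho b$, then $$\max_{b\in\mathcal K}\mathrm{OPT}_b^+(\mathcal M)\ge\frac1\varrho\,\mathrm{OPT}_{\psi,\gamma}(\mathcal M).$$ In particular, the dyadic grid $\{2^j:j=0,1,\dots,\lceil\log_2K_{\max}\rceil\}\cap\{1,\dots,K_{\max}\}$ gives a $1/2$-approximation, i.e. the left-hand side is at least $\frac12\mathrm{OPT}_{\psi,\gamma}(\mathcal M)$; and for $\eta\in(0,1)$ and $\varrho=1/(1-\eta)$, the ratio-$\varrho$ grid $\{\lceil\varrho^j\rceil:j=0,1,\dots,\lceil\log_\varrho K_{\max}\rceil\}\cap\{1,\dots,K_{\max}\}$ gives a $(1-\eta)$-approximation and contains $O(\eta^{-1}\log K_{\max})$ sizes (so uses that many fixed-size solves; the $O$-bound is understood for $K_{\max}\ge2$).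
   Context: Setting. There are $n\ge1$ development tasks $i=1,\dots,n$ and workflow types $g$ in a finite pool $\mathcal M$, with correctness indicators $a_{ig}\in\{0,1\}$, execution costs $c_g\ge0$, cost price $\gamma\ge0$, and an integer $K_{\max}\ge1$. For $\boldsymbol m\in\mathbb Z_+^{\mathcal M}$ put $k(\boldsymbol m)=\sum_g m_g$, $r_i(\boldsymbol m)=\sum_g a_{ig}m_g$, $C(\boldsymbol m)=\sum_g c_gm_g$. Recovery curves are functions $\psi_k:\{0,\dots,k\}\to[0,1]$ with $\psi_k(0)=0$, $\psi_k(k)=1$. For $\boldsymbol m\neq\boldsymbol 0$ with $k(\boldsymbol m)\le K_{\max}$, $\Pi_{\psi,\gamma}(\boldsymbol m)=\frac1n\sum_{i=1}^n\psi_{k(\boldsymbol m)}(r_i(\boldsymbol m))-\gamma C(\boldsymbol m)$, and $\Pi_{\psi,\gamma}(\boldsymbol 0)=0$. Define $\mathrm{OPT}_k(\mathcal M)=\max\{\Pi_{\psi,\gamma}(\boldsymbol m):\boldsymbol m\in\mathbb Z_+^{\mathcal M},\ k(\boldsymbol m)=k\}$ and $\mathrm{OPT}_{\psi,\gamma}(\mathcal M)=\max\{\Pi_{\psi,\gamma}(\boldsymbol m):\boldsymbol m\in\mathbb Z_+^{\mathcal M},\ k(\boldsymbol m)\le K_{\max}\}$. A fixed-size solve means computing $\mathrm{OPT}_b(\mathcal M)$ for one $b$. *)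

theory Defs
  imports "HOL-Analysis.Convex" "HOL-Library.FuncSet"
begin

text \<open>Tasks are the indices \<open>1, \<dots>, n\<close>; the pool is a finite set \<open>M\<close>. Elements of
  \<open>\<int>\<^sub>+\<^sup>M\<close> are extensional functions, so that each vector is represented exactly once.\<close>

definition multiplicities :: "'g set \<Rightarrow> ('g \<Rightarrow> nat) set" where
  "multiplicities M = M \<rightarrow>\<^sub>E UNIV"

definition total :: "'g set \<Rightarrow> ('g \<Rightarrow> nat) \<Rightarrow> nat" where
  "total M m = (\<Sum>g\<in>M. m g)"

definition num_correct :: "'g set \<Rightarrow> (nat \<Rightarrow> 'g \<Rightarrow> nat) \<Rightarrow> nat \<Rightarrow> ('g \<Rightarrow> nat) \<Rightarrow> nat" where
  "num_correct M a i m = (\<Sum>g\<in>M. a i g * m g)"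

definition cost :: "'g set \<Rightarrow> ('g \<Rightarrow> real) \<Rightarrow> ('g \<Rightarrow> nat) \<Rightarrow> real" where
  "cost M c m = (\<Sum>g\<in>M. c g * real (m g))"

text \<open>There is no curve for \<open>k = 0\<close>: the two boundary conditions would contradict each other.\<close>

definition recovery_curves :: "nat \<Rightarrow> (nat \<Rightarrow> nat \<Rightarrow> real) \<Rightarrow> bool" where
  "recovery_curves Kmax \<psi> \<longleftrightarrow>
     (\<forall>k\<in>{1..Kmax}. \<psi> k \<in> {0..k} \<rightarrow> {0..1} \<and> \<psi> k 0 = 0 \<and> \<psi> k k = 1)"

definition payoff ::
  "nat \<Rightarrow> 'g set \<Rightarrow> (nat \<Rightarrow> 'g \<Rightarrow> nat) \<Rightarrow> ('g \<Rightarrow> real) \<Rightarrow> (nat \<Rightarrow> nat \<Rightarrow> real) \<Rightarrow> real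
    \<Rightarrow> ('g \<Rightarrow> nat) \<Rightarrow> real" where
  "payoff n M a c \<psi> \<gamma> m =
     (if \<forall>g\<in>M. m g = 0 then 0
      else (1 / real n) * (\<Sum>i=1..n. \<psi> (total M m) (num_correct M a i m)) - \<gamma> * cost M c m)"

definition opt_size ::
  "nat \<Rightarrow> 'g set \<Rightarrow> (nat \<Rightarrow> 'g \<Rightarrow> nat) \<Rightarrow> ('g \<Rightarrow> real) \<Rightarrow> (nat \<Rightarrow> nat \<Rightarrow> real) \<Rightarrow> real
    \<Rightarrow> nat \<Rightarrow> real" where
  "opt_size n M a c \<psi> \<gamma> k =
     Max (payoff n M a c \<psi> \<gamma> ` {m \<in> multiplicities M. total M m = k})"

definition opt_size_pos ::
  "nat \<Rightarrow> 'g set \<Rightarrow> (nat \<Rightarrow> 'g \<Rightarrow> nat) \<Rightarrow> ('g \<Rightarrow> real) \<Rightarrow> (nat \<Rightarrow> nat \<Rightarrow> real) \<Rightarrow> real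
    \<Rightarrow> nat \<Rightarrow> real" where
  "opt_size_pos n M a c \<psi> \<gamma> k = max 0 (opt_size n M a c \<psi> \<gamma> k)"

definition opt ::
  "nat \<Rightarrow> 'g set \<Rightarrow> (nat \<Rightarrow> 'g \<Rightarrow> nat) \<Rightarrow> ('g \<Rightarrow> real) \<Rightarrow> (nat \<Rightarrow> nat \<Rightarrow> real) \<Rightarrow> real
    \<Rightarrow> nat \<Rightarrow> real" where
  "opt n M a c \<psi> \<gamma> Kmax =
     Max (payoff n M a c \<psi> \<gamma> ` {m \<in> multiplicities M. total M m \<le> Kmax})"

definition coverage_ratio :: "nat \<Rightarrow> nat set \<Rightarrow> real \<Rightarrow> bool" where
  "coverage_ratio Kmax \<K> \<rho> \<longleftrightarrow>
     \<rho> \<ge> 1 \<and> (\<forall>k\<in>{1..Kmax}. \<exists>b\<in>\<K>. b \<le> k \<and> real k \<le> \<rho> * real b)"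

definition dyadic_grid :: "nat \<Rightarrow> nat set" where
  "dyadic_grid Kmax = {2 ^ j | j :: nat. int j \<le> \<lceil>log 2 (real Kmax)\<rceil>} \<inter> {1..Kmax}"

definition ratio_grid :: "real \<Rightarrow> nat \<Rightarrow> nat set" where
  "ratio_grid \<rho> Kmax =
     {nat \<lceil>\<rho> ^ j\<rceil> | j :: nat. int j \<le> \<lceil>log \<rho> (real Kmax)\<rceil>} \<inter> {1..Kmax}"

text \<open>The maxima above range over finite nonempty sets.\<close>

lemma finite_multiplicities_le:
  assumes "finite M"
  shows "finite {m \<in> multiplicities M. total M m \<le> K}"
proof (rule finite_subset)
  show "{m \<in> multiplicities M. total M m \<le> K} \<subseteq> M \<rightarrow>\<^sub>E {..K}"
  proof
    fix m assume m: "m \<in> {m \<in> multiplicities M. total M m \<le> K}"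
    have "m g \<le> K" if "g \<in> M" for g
      using m member_le_sum[OF that, of m] assms by (auto simp: total_def)
    then show "m \<in> M \<rightarrow>\<^sub>E {..K}"
      using m by (auto simp: multiplicities_def PiE_iff)
  qed
  show "finite (M \<rightarrow>\<^sub>E {..K})"
    using assms by (simp add: finite_PiE)
qed

lemma finite_multiplicities_eq:
  assumes "finite M"
  shows "finite {m \<in> multiplicities M. total M m = k}"
  by (rule finite_subset[OF _ finite_multiplicities_le[OF assms, of k]]) auto

lemma multiplicities_eq_nonempty:
  assumes "finite M" and "M \<noteq> {}"
  shows "{m \<in> multiplicities M. total M m = k} \<noteq> {}"
proof -
  obtain g0 where g0: "g0 \<in> M" using assms by auto
  let ?m = "\<lambda>g\<in>M. if g = g0 then k else 0"
  have "total M ?m = k"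
    using g0 assms by (simp add: total_def)
  then have "?m \<in> {m \<in> multiplicities M. total M m = k}"
    by (simp add: multiplicities_def)
  then show ?thesis by blast
qed

end

theory Submission
  imports Defs
begin

text \<open>Delete one of the \<open>k\<close> executions of a multiset \<open>m\<close>, chosen uniformly at random. The expected
  cost shrinks exactly by the factor \<open>(k - 1) / k\<close>. If \<open>r\<close> of the executions are correct for a task,
  then \<open>r'\<close> correct ones survive with \<open>r' / (k - 1) \<ge> (r' / r) (r / k)\<close>, so monotonicity, concavity and
  \<open>h 0 = 0\<close> give \<open>h (r' / (k - 1)) \<ge> (r' / r) h (r / k)\<close>; as \<open>r'\<close> has mean \<open>r (k - 1) / k\<close>, the expected
  payoff is at least \<open>(k - 1) / k\<close> times that of \<open>m\<close>. Hence the optimum per execution is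
  nonincreasing in the size. A grid point within a factor \<open>\<rho>\<close> below the optimal size therefore loses
  at most that factor.\<close>

text \<open>Concavity between \<open>0\<close> and \<open>y\<close> with \<open>h 0 = 0\<close>
  gives \<open>t * h y \<le> h (t * y)\<close>; monotonicity then moves the argument up to
  \<open>x\<close>. It is applied with \<open>t = r'/r\<close>, \<open>y = r/(k + 1)\<close>,
  \<open>x = r'/k\<close>.\<close>

lemma concave_mono_scale:
  fixes h :: "real \<Rightarrow> real"
  assumes "mono_on {0..1} h" "concave_on {0..1} h" "h 0 = 0"
    and "0 \<le> t" "t \<le> 1" "0 \<le> y" "y \<le> 1" "t * y \<le> x" "x \<le> 1"
  shows "t * h y \<le> h x"
proof -
  have ty: "0 \<le> t * y" using assms by simp
  then have x0: "0 \<le> x" using assms(8) by linarith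
  have "(1 - t) * h 0 + t * h y \<le> h ((1 - t) *\<^sub>R 0 + t *\<^sub>R y)"
    by (rule concave_onD[OF assms(2)]) (use assms in auto)
  then have "t * h y \<le> h (t * y)" using assms(3) by simp
  also have "\<dots> \<le> h x"
    by (rule mono_onD[OF assms(1)]) (use assms ty x0 in auto)
  finally show ?thesis .
qed

text \<open>One identity for the effect of a deletion on size, correct counts and cost, with weights
  \<open>1\<close>, \<open>a i\<close> and \<open>c\<close>. Working in a ring avoids truncated
  subtraction on the right.\<close>

lemma sum_remove_one:
  fixes w :: "'g \<Rightarrow> 'a::comm_ring_1" and m :: "'g \<Rightarrow> nat"
  assumes "finite M" "g \<in> M" "m g > 0"
  shows "(\<Sum>x\<in>M. w x * of_nat ((m(g := m g - 1)) x)) = (\<Sum>x\<in>M. w x * of_nat (m x)) - w g"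
proof -
  have "(\<Sum>x\<in>M - {g}. w x * of_nat ((m(g := m g - 1)) x)) = (\<Sum>x\<in>M - {g}. w x * of_nat (m x))"
    by (rule sum.cong) auto
  with assms show ?thesis
    by (simp add: sum.remove[of M g] of_nat_diff algebra_simps)
qed

section \<open>Optimal payoffs under concave recovery\<close>

locale concave_recovery =
  fixes n Kmax :: nat
    and M :: "'g set"
    and a :: "nat \<Rightarrow> 'g \<Rightarrow> nat"
    and c :: "'g \<Rightarrow> real"
    and \<gamma> :: real
    and \<psi> :: "nat \<Rightarrow> nat \<Rightarrow> real"
    and h :: "real \<Rightarrow> real"
  assumes fin: "finite M" and ne: "M \<noteq> {}"
    and a_le: "\<And>i g. i \<in> {1..n} \<Longrightarrow> g \<in> M \<Longrightarrow> a i g \<le> 1"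
    and h_mono: "mono_on {0..1} h" and h_conc: "concave_on {0..1} h" and h0: "h 0 = 0"
    and psi: "\<And>k r. k \<in> {1..Kmax} \<Longrightarrow> r \<le> k \<Longrightarrow> \<psi> k r = h (real r / real k)"
begin

lemma num_correct_le_total: "i \<in> {1..n} \<Longrightarrow> num_correct M a i m \<le> total M m"
  unfolding num_correct_def total_def
  using a_le by (intro sum_mono) (metis mult_le_mono1 nat_mult_1)

lemma payoff_eq:
  assumes "total M m = k" "k \<in> {1..Kmax}"
  shows "payoff n M a c \<psi> \<gamma> m =
    (1 / real n) * (\<Sum>i=1..n. h (real (num_correct M a i m) / real k)) - \<gamma> * cost M c m"
proof -
  \<comment> \<open>Size at least 1 rules out the zero vector, whose payoff is set
    separately.\<close>
  have "\<not> (\<forall>g\<in>M. m g = 0)"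
    using assms by (force simp: total_def)
  moreover have "\<psi> k (num_correct M a i m) = h (real (num_correct M a i m) / real k)" if "i \<in> {1..n}" for i
    using psi[OF assms(2)] num_correct_le_total[OF that, of m] assms(1) by simp
  ultimately show ?thesis
    unfolding payoff_def assms(1) by auto
qed

lemma payoff_le_opt_size: "m \<in> multiplicities M \<Longrightarrow> payoff n M a c \<psi> \<gamma> m \<le> opt_size n M a c \<psi> \<gamma> (total M m)"
  unfolding opt_size_def
  by (rule Max_ge) (auto simp: finite_multiplicities_eq[OF fin])

lemma opt_size_attained:
  obtains m where "m \<in> multiplicities M" "total M m = k" "opt_size n M a c \<psi> \<gamma> k = payoff n M a c \<psi> \<gamma> m"
proof -
  have "opt_size n M a c \<psi> \<gamma> k \<in> payoff n M a c \<psi> \<gamma> ` {m \<in> multiplicities M. total M m = k}"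
    unfolding opt_size_def
    by (rule Max_in) (use finite_multiplicities_eq[OF fin] multiplicities_eq_nonempty[OF fin ne] in auto)
  then show ?thesis using that by blast
qed

text \<open>There are \<open>m g\<close> ways to delete an execution of type \<open>g\<close>, so
  the right side is \<open>k + 1\<close> times the expected recovery of task \<open>i\<close> after
  a uniform deletion.\<close>

lemma recovery_remove_one:
  assumes k: "total M m = Suc k" "1 \<le> k" and i: "i \<in> {1..n}"
  shows "real k * h (real (num_correct M a i m) / real (Suc k))
    \<le> (\<Sum>g\<in>M. real (m g) * h ((real (num_correct M a i m) - real (a i g)) / real k))"
proof -
  define r where "r = num_correct M a i m"
  have r: "real r = (\<Sum>g\<in>M. real (a i g) * real (m g))"
    by (simp add: r_def num_correct_def)
  have tot: "(\<Sum>g\<in>M. real (m g)) = real k + 1"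
    using k by (simp add: total_def flip: of_nat_sum)
  have rk: "r \<le> Suc k" using num_correct_le_total[OF i, of m] k by (simp add: r_def)
  show ?thesis
  proof (cases "r = 0")
    case True
    \<comment> \<open>If \<open>r = 0\<close>, either the weight \<open>m g\<close> vanishes or
      \<open>a i g = 0\<close> and \<open>h\<close> is evaluated at 0. The case is separate because
      the scaling factor below divides by \<open>r\<close>.\<close>
    have "real (m g) * h (- real (a i g) / real k) = 0" if "g \<in> M" for g
      using that True fin by (auto simp: r_def num_correct_def h0)
    then have "(\<Sum>g\<in>M. real (m g) * h (- real (a i g) / real k)) = 0"
      by (intro sum.neutral) blast
    then show ?thesis
      using True by (simp add: r_def h0)
  next
    case False
    have step: "real (m g) * ((real r - real (a i g)) / real r * h (real r / real (Suc k)))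
      \<le> real (m g) * h ((real r - real (a i g)) / real k)" if g: "g \<in> M" for g
    proof (cases "m g = 0")
      case mg: False
      have ag: "a i g = 0 \<or> a i g = 1" using a_le[OF i g] by auto
      \<comment> \<open>Keeps the argument of \<open>h\<close> at most 1. Only
        \<open>r = k + 1\<close> with \<open>a i g = 0\<close> could violate it, but an incorrect
        type that occurs in \<open>m\<close> forces \<open>r\<close> below the size.\<close>
      have upper: "real r - real (a i g) \<le> real k"
      proof (cases "r = Suc k")
        case True
        have "a i g \<noteq> 0"
        proof
          assume "a i g = 0"
          then have "r < total M m"
            unfolding r_def num_correct_def total_def
            using g mg a_le[OF i] fin by (intro sum_strict_mono_ex1) (auto simp: Suc_le_eq)
          then show False using True k by simp
        qed
        then show ?thesis using True ag by auto
      next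
        case False
        then show ?thesis using rk by simp
      qed
      have lower: "real (a i g) \<le> real r" using ag False by auto
      have "(real r - real (a i g)) / real r * h (real r / real (Suc k))
        \<le> h ((real r - real (a i g)) / real k)"
      proof (rule concave_mono_scale[OF h_mono h_conc h0])
        have "(real r - real (a i g)) / real r * (real r / real (Suc k))
          = (real r - real (a i g)) / real (Suc k)" using False by simp
        also have "\<dots> \<le> (real r - real (a i g)) / real k"
          using lower k by (intro divide_left_mono) auto
        finally show "(real r - real (a i g)) / real r * (real r / real (Suc k))
          \<le> (real r - real (a i g)) / real k" .
      qed (use False lower upper k rk in \<open>auto simp: divide_le_eq_1\<close>)
      then show ?thesis by (intro mult_left_mono) auto
    qed simp
    \<comment> \<open>Each of the \<open>k + 1\<close> deletions starts from \<open>r\<close>, and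
      exactly \<open>r\<close> of them lose a correct execution:
      \<open>(k + 1) r - r = k r\<close>.\<close>
    have "(\<Sum>g\<in>M. real (m g) * (real r - real (a i g))) = real r * real k"
      using r tot by (simp add: right_diff_distrib sum_subtractf mult.commute flip: sum_distrib_right)
        (simp add: algebra_simps)
    then have "real k * h (real r / real (Suc k))
      = (\<Sum>g\<in>M. real (m g) * (real r - real (a i g))) / real r * h (real r / real (Suc k))"
      using False by simp
    also have "\<dots> = (\<Sum>g\<in>M. real (m g) * ((real r - real (a i g)) / real r * h (real r / real (Suc k))))"
      by (simp add: sum_divide_distrib sum_distrib_right mult.assoc)
    also have "\<dots> \<le> (\<Sum>g\<in>M. real (m g) * h ((real r - real (a i g)) / real k))"
      by (rule sum_mono) (rule step)
    finally show ?thesis by (simp add: r_def)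
  qed
qed

text \<open>The payoffs after the \<open>k + 1\<close> possible deletions sum to at least
  \<open>k\<close> times the payoff of \<open>m\<close>, while none of them exceeds the optimum for
  size \<open>k\<close>.\<close>

lemma payoff_remove_one:
  assumes m: "m \<in> multiplicities M" and k: "total M m = Suc k" "1 \<le> k" "Suc k \<le> Kmax"
  shows "real k * payoff n M a c \<psi> \<gamma> m \<le> real (Suc k) * opt_size n M a c \<psi> \<gamma> k"
proof -
  let ?O = "opt_size n M a c \<psi> \<gamma> k"
  \<comment> \<open>The payoff after deleting one execution of type \<open>g\<close>, given by a
    formula that makes sense also for \<open>m g = 0\<close>, where there is nothing to delete and
    the weight is 0.\<close>
  define P where "P g = (1 / real n) * (\<Sum>i=1..n. h ((real (num_correct M a i m) - real (a i g)) / real k))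
    - \<gamma> * (cost M c m - c g)" for g
  have tot: "(\<Sum>g\<in>M. real (m g)) = real (Suc k)"
    using k by (simp add: total_def flip: of_nat_sum)
  have P_le: "real (m g) * P g \<le> real (m g) * ?O" if g: "g \<in> M" for g
  proof (cases "m g = 0")
    case False
    define m' where "m' = m(g := m g - 1)"
    have mem: "m' \<in> multiplicities M"
      using m g by (auto simp: m'_def multiplicities_def PiE_iff extensional_def)
    have "int (total M m') = int (total M m) - 1"
      using sum_remove_one[OF fin g, of m "\<lambda>_. 1::int"] False by (simp add: total_def m'_def)
    then have total': "total M m' = k" using k by simp
    have "real (num_correct M a i m') = real (num_correct M a i m) - real (a i g)" for i
      using sum_remove_one[OF fin g, of m "\<lambda>x. real (a i x)"] False
      by (simp add: num_correct_def m'_def)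
    moreover have "cost M c m' = cost M c m - c g"
      using sum_remove_one[OF fin g, of m c] False by (simp add: cost_def m'_def)
    ultimately have "P g = payoff n M a c \<psi> \<gamma> m'"
      using k by (subst payoff_eq[OF total']) (auto simp: P_def)
    also have "\<dots> \<le> ?O"
      using payoff_le_opt_size[OF mem] total' by simp
    finally show ?thesis by (intro mult_left_mono) auto
  qed simp
  have "real k * payoff n M a c \<psi> \<gamma> m
    = (1 / real n) * (\<Sum>i=1..n. real k * h (real (num_correct M a i m) / real (Suc k)))
      - \<gamma> * (real k * cost M c m)"
    using k by (subst payoff_eq[OF k(1)]) (auto simp: right_diff_distrib sum_distrib_left mult_ac)
  also have "\<dots> \<le> (1 / real n) * (\<Sum>i=1..n. \<Sum>g\<in>M. real (m g) * h ((real (num_correct M a i m) - real (a i g)) / real k))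
      - \<gamma> * (real k * cost M c m)"
    using recovery_remove_one[OF k(1,2)] by (intro diff_right_mono mult_left_mono sum_mono) auto
  \<comment> \<open>The cost part is exact: summed over all deletions, the removed costs make up the
    total cost once.\<close>
  also have "real k * cost M c m = (\<Sum>g\<in>M. real (m g) * (cost M c m - c g))"
  proof -
    have "(\<Sum>g\<in>M. real (m g) * (cost M c m - c g))
      = (\<Sum>g\<in>M. real (m g)) * cost M c m - (\<Sum>g\<in>M. c g * real (m g))"
      by (simp add: right_diff_distrib sum_subtractf sum_distrib_left mult.commute)
    then show ?thesis unfolding tot cost_def[symmetric] by (simp add: algebra_simps)
  qed
  also have "(1 / real n) * (\<Sum>i=1..n. \<Sum>g\<in>M. real (m g) * h ((real (num_correct M a i m) - real (a i g)) / real k))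
      - \<gamma> * (\<Sum>g\<in>M. real (m g) * (cost M c m - c g)) = (\<Sum>g\<in>M. real (m g) * P g)"
    unfolding P_def
    by (subst sum.swap) (simp add: right_diff_distrib sum_subtractf sum_distrib_left mult_ac)
  also have "\<dots> \<le> (\<Sum>g\<in>M. real (m g) * ?O)"
    by (rule sum_mono) (rule P_le)
  also have "\<dots> = real (Suc k) * ?O"
    using tot by (simp only: flip: sum_distrib_right)
  finally show ?thesis .
qed

text \<open>By the deletion bound, the optimum divided by the size does not increase from
  \<open>k\<close> to \<open>k + 1\<close>; induction runs upward from \<open>b\<close>.\<close>

lemma opt_size_scale:
  assumes "b \<le> k" "1 \<le> b" "k \<le> Kmax"
  shows "real b / real k * opt_size n M a c \<psi> \<gamma> k \<le> opt_size n M a c \<psi> \<gamma> b"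
  using assms
proof (induction k rule: dec_induct)
  case base
  then show ?case by simp
next
  case (step k)
  let ?O = "opt_size n M a c \<psi> \<gamma>"
  obtain m where "m \<in> multiplicities M" "total M m = Suc k" "?O (Suc k) = payoff n M a c \<psi> \<gamma> m"
    by (rule opt_size_attained)
  then have "real k * ?O (Suc k) \<le> real (Suc k) * ?O k"
    using payoff_remove_one[of m k] step by simp
  then have "?O (Suc k) / real (Suc k) \<le> ?O k / real k"
    using step by (simp add: field_simps)
  then have "real b * (?O (Suc k) / real (Suc k)) \<le> real b * (?O k / real k)"
    by (intro mult_left_mono) auto
  with step show ?case by simp
qed

text \<open>Truncation at 0 respects scaling by the nonnegative factor \<open>b / k\<close>.\<close>

lemma opt_size_pos_scale:
  assumes "1 \<le> b" "b \<le> k" "k \<le> Kmax"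
  shows "real b / real k * opt_size_pos n M a c \<psi> \<gamma> k \<le> opt_size_pos n M a c \<psi> \<gamma> b"
  using opt_size_scale[OF assms(2,1,3)] by (auto simp: opt_size_pos_def max_def)

lemma opt_le_grid:
  assumes grid: "\<K> \<subseteq> {1..Kmax}" and cov: "coverage_ratio Kmax \<K> \<rho>" and K: "1 \<le> Kmax"
  shows "1 / \<rho> * opt n M a c \<psi> \<gamma> Kmax \<le> Max (opt_size_pos n M a c \<psi> \<gamma> ` \<K>)"
proof -
  let ?p = "opt_size_pos n M a c \<psi> \<gamma>" and ?A = "Max (opt_size_pos n M a c \<psi> \<gamma> ` \<K>)"
  have \<rho>: "1 \<le> \<rho>" using cov by (simp add: coverage_ratio_def)
  have "finite \<K>" using grid by (rule finite_subset) simp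
  then have le_A: "?p b \<le> ?A" if "b \<in> \<K>" for b
    using that by (intro Max_ge) auto
  \<comment> \<open>As \<open>Kmax \<ge> 1\<close>, coverage makes the grid nonempty, so
    \<open>?A\<close> is a genuine maximum. Its nonnegativity handles the zero vector.\<close>
  obtain b0 where "b0 \<in> \<K>" using cov K by (auto simp: coverage_ratio_def)
  then have A0: "0 \<le> ?A" using le_A[of b0] by (simp add: opt_size_pos_def)
  have bound: "payoff n M a c \<psi> \<gamma> m \<le> \<rho> * ?A" if m: "m \<in> multiplicities M" "total M m \<le> Kmax" for m
  proof (cases "total M m = 0")
    case True
    then have "\<forall>g\<in>M. m g = 0" using fin by (simp add: total_def)
    then show ?thesis using A0 \<rho> by (simp add: payoff_def)
  next
    case False
    define k where "k = total M m"
    then have "k \<in> {1..Kmax}" using False m by simp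
    then obtain b where b: "b \<in> \<K>" "b \<le> k" "real k \<le> \<rho> * real b"
      using cov unfolding coverage_ratio_def by blast
    with grid have b1: "1 \<le> b" by auto
    have p0: "0 \<le> ?p b" by (simp add: opt_size_pos_def)
    have "real b / real k * ?p k \<le> ?p b"
      using b b1 m by (intro opt_size_pos_scale) (auto simp: k_def)
    then have "real b * ?p k \<le> real k * ?p b"
      using b b1 by (simp add: field_simps)
    also have "\<dots> \<le> (\<rho> * real b) * ?p b"
      using b p0 by (intro mult_right_mono) auto
    finally have "real b * ?p k \<le> real b * (\<rho> * ?p b)"
      by (simp add: mult_ac)
    then have "?p k \<le> \<rho> * ?p b" using b1 by simp
    also have "\<dots> \<le> \<rho> * ?A" using le_A[OF b(1)] \<rho> by simp
    finally show ?thesis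
      using payoff_le_opt_size[OF m(1)] by (simp add: opt_size_pos_def k_def)
  qed
  have "{m \<in> multiplicities M. total M m \<le> Kmax} \<noteq> {}"
    using multiplicities_eq_nonempty[OF fin ne, of Kmax] by auto
  then have "opt n M a c \<psi> \<gamma> Kmax \<le> \<rho> * ?A"
    unfolding opt_def using finite_multiplicities_le[OF fin] bound by (subst Max_le_iff) auto
  then show ?thesis using \<rho> by (simp add: field_simps)
qed

end

section \<open>Cardinality grids: coverage and number of sizes\<close>

lemma coverage_ratio_grid:
  assumes "1 < \<rho>"
  shows "coverage_ratio K (ratio_grid \<rho> K) \<rho>"
  unfolding coverage_ratio_def
proof (intro conjI ballI)
  fix k assume k: "k \<in> {1..K}"
  \<comment> \<open>The exponent with \<open>\<rho> ^ j \<le> k < \<rho> ^ (j + 1)\<close>. As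
    \<open>k\<close> is an integer, rounding \<open>\<rho> ^ j\<close> up stays at most
    \<open>k\<close>, and it only improves the ratio bound.\<close>
  define j where "j = nat \<lfloor>log \<rho> (real k)\<rfloor>"
  define b where "b = nat \<lceil>\<rho> ^ j\<rceil>"
  have log0: "0 \<le> log \<rho> (real k)" using k assms by simp
  then have j: "real j \<le> log \<rho> (real k)" "log \<rho> (real k) < real (Suc j)"
    unfolding j_def by linarith+
  have "\<rho> ^ j \<le> real k"
    using j(1) assms k by (simp add: le_log_iff powr_realpow)
  moreover have "real k < \<rho> ^ Suc j"
    using j(2) assms k by (simp add: log_less_iff powr_realpow del: of_nat_Suc power_Suc)
  moreover have "1 \<le> \<rho> ^ j" using assms by simp
  ultimately have b: "1 \<le> b" "b \<le> k" "\<rho> ^ j \<le> real b"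
    unfolding b_def by linarith+
  have "log \<rho> (real k) \<le> log \<rho> (real K)" using k assms by simp
  with j(1) have "int j \<le> \<lceil>log \<rho> (real K)\<rceil>" by linarith
  with b k have "b \<in> ratio_grid \<rho> K" by (auto simp: ratio_grid_def b_def)
  moreover have "real k \<le> \<rho> * real b"
  proof -
    have "real k \<le> \<rho> * \<rho> ^ j" using \<open>real k < \<rho> ^ Suc j\<close> by simp
    also have "\<dots> \<le> \<rho> * real b" using b assms by simp
    finally show ?thesis .
  qed
  ultimately show "\<exists>b\<in>ratio_grid \<rho> K. b \<le> k \<and> real k \<le> \<rho> * real b"
    using b by blast
qed (use assms in simp)

text \<open>Powers of 2 are unchanged by rounding, so the dyadic guarantee is the case
  \<open>\<rho> = 2\<close>.\<close>

lemma dyadic_grid_eq_ratio_grid: "dyadic_grid K = ratio_grid 2 K"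
proof -
  have "nat \<lceil>(2::real) ^ j\<rceil> = 2 ^ j" for j
    by (metis ceiling_of_nat nat_int of_nat_numeral of_nat_power)
  then show ?thesis unfolding dyadic_grid_def ratio_grid_def by metis
qed

text \<open>The exponents run from 0 to the rounded-up logarithm, one more than that number.
  Rounding may identify grid points, so this is an upper bound only.\<close>

lemma card_ratio_grid_le:
  assumes "1 < \<rho>" "1 \<le> K"
  shows "real (card (ratio_grid \<rho> K)) \<le> log \<rho> (real K) + 2"
proof -
  define J where "J = nat \<lceil>log \<rho> (real K)\<rceil>"
  have log0: "0 \<le> log \<rho> (real K)" using assms by simp
  have "ratio_grid \<rho> K \<subseteq> (\<lambda>j. nat \<lceil>\<rho> ^ j\<rceil>) ` {..J}"
    using log0 by (auto simp: ratio_grid_def J_def le_nat_iff)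
  then have "card (ratio_grid \<rho> K) \<le> card {..J}"
    by (rule surj_card_le[rotated]) simp
  then show ?thesis using log0 unfolding J_def by simp linarith
qed

text \<open>The estimate \<open>- ln (1 - \<eta>) \<ge> \<eta>\<close> bounds the logarithm by
  \<open>ln K / \<eta>\<close>. Since \<open>ln K / \<eta> \<ge> ln 2\<close>, the additive 2 is
  absorbed at the price of \<open>2 / ln 2\<close> in the constant.\<close>

lemma card_ratio_grid_bound:
  assumes \<eta>: "0 < \<eta>" "\<eta> < 1" and K: "2 \<le> K"
  shows "real (card (ratio_grid (1 / (1 - \<eta>)) K)) \<le> (1 + 2 / ln 2) * (1 / \<eta> * ln (real K))"
proof -
  have ln\<rho>: "\<eta> \<le> ln (1 / (1 - \<eta>))"
    using ln_le_minus_one[of "1 - \<eta>"] \<eta> by (simp add: ln_div)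
  have lnK: "ln 2 \<le> ln (real K)" using K by simp
  have ln2: "0 < ln (2::real)" by simp
  have "log (1 / (1 - \<eta>)) (real K) \<le> 1 / \<eta> * ln (real K)"
    using ln\<rho> \<eta> lnK order.trans[OF less_imp_le[OF ln2] lnK] frac_le[of "ln (real K)" "ln (real K)" \<eta> "ln (1 / (1 - \<eta>))"]
    by (simp add: log_def)
  moreover have "2 \<le> 2 / ln 2 * (1 / \<eta> * ln (real K))"
  proof -
    have "ln 2 \<le> 1 / \<eta> * ln (real K)"
      using mult_mono[of 1 "1 / \<eta>" "ln 2" "ln (real K)"] \<eta> lnK by simp
    then show ?thesis using mult_left_mono[of "ln 2" "1 / \<eta> * ln (real K)" "2 / ln 2"] by simp
  qed
  moreover have "real (card (ratio_grid (1 / (1 - \<eta>)) K)) \<le> log (1 / (1 - \<eta>)) (real K) + 2"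
    using \<eta> K by (intro card_ratio_grid_le) auto
  ultimately show ?thesis unfolding distrib_right by linarith
qed

theorem theorem2:
  fixes n Kmax :: nat
    and M :: "'g set"
    and a :: "nat \<Rightarrow> 'g \<Rightarrow> nat"
    and c :: "'g \<Rightarrow> real"
    and \<gamma> :: real
    and \<psi> :: "nat \<Rightarrow> nat \<Rightarrow> real"
    and h :: "real \<Rightarrow> real"
  assumes "n \<ge> 1" and "Kmax \<ge> 1"
    and "finite M" and "M \<noteq> {}"
    and "\<And>i g. i \<in> {1..n} \<Longrightarrow> g \<in> M \<Longrightarrow> a i g \<in> {0, 1}"
    and "\<And>g. g \<in> M \<Longrightarrow> c g \<ge> 0" and "\<gamma> \<ge> 0"
    and "recovery_curves Kmax \<psi>"
    and "h \<in> {0..1} \<rightarrow> {0..1}" and "mono_on {0..1} h" and "concave_on {0..1} h" and "h 0 = 0"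
    and "\<And>k r. k \<in> {1..Kmax} \<Longrightarrow> r \<le> k \<Longrightarrow> \<psi> k r = h (real r / real k)"
  shows "(\<forall>b k. 1 \<le> b \<longrightarrow> b \<le> k \<longrightarrow> k \<le> Kmax \<longrightarrow>
            opt_size_pos n M a c \<psi> \<gamma> b \<ge> real b / real k * opt_size_pos n M a c \<psi> \<gamma> k)
       \<and> (\<forall>\<K> \<rho>. \<K> \<subseteq> {1..Kmax} \<longrightarrow> coverage_ratio Kmax \<K> \<rho> \<longrightarrow>
            Max (opt_size_pos n M a c \<psi> \<gamma> ` \<K>) \<ge> 1 / \<rho> * opt n M a c \<psi> \<gamma> Kmax)
       \<and> Max (opt_size_pos n M a c \<psi> \<gamma> ` dyadic_grid Kmax) \<ge> 1 / 2 * opt n M a c \<psi> \<gamma> Kmax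
       \<and> (\<forall>\<eta>. 0 < \<eta> \<longrightarrow> \<eta> < 1 \<longrightarrow>
            Max (opt_size_pos n M a c \<psi> \<gamma> ` ratio_grid (1 / (1 - \<eta>)) Kmax)
              \<ge> (1 - \<eta>) * opt n M a c \<psi> \<gamma> Kmax)
       \<and> (\<exists>C>0. \<forall>(\<eta>::real) (K::nat). 0 < \<eta> \<longrightarrow> \<eta> < 1 \<longrightarrow> 2 \<le> K \<longrightarrow>
            real (card (ratio_grid (1 / (1 - \<eta>)) K)) \<le> C * (1 / \<eta> * ln (real K)))"
proof -
  interpret concave_recovery n Kmax M a c \<gamma> \<psi> h
  proof
    show "a i g \<le> 1" if "i \<in> {1..n}" "g \<in> M" for i g
      using assms(5)[OF that] by auto
  qed (fact assms)+
  have grid: "1 / \<rho> * opt n M a c \<psi> \<gamma> Kmax \<le> Max (opt_size_pos n M a c \<psi> \<gamma> ` ratio_grid \<rho> Kmax)"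
    if "1 < \<rho>" for \<rho>
    by (rule opt_le_grid) (use that assms(2) coverage_ratio_grid in \<open>auto simp: ratio_grid_def\<close>)
  \<comment> \<open>The witness for \<open>C\<close>, uniform in \<open>\<eta>\<close> and
    \<open>K\<close>.\<close>
  have "0 < 1 + 2 / ln (2::real)" by (simp add: add_pos_pos)
  then have "\<exists>C>0. \<forall>(\<eta>::real) (K::nat). 0 < \<eta> \<longrightarrow> \<eta> < 1 \<longrightarrow> 2 \<le> K \<longrightarrow>
      real (card (ratio_grid (1 / (1 - \<eta>)) K)) \<le> C * (1 / \<eta> * ln (real K))"
    using card_ratio_grid_bound by blast
  moreover have "(1 - \<eta>) * opt n M a c \<psi> \<gamma> Kmax
      \<le> Max (opt_size_pos n M a c \<psi> \<gamma> ` ratio_grid (1 / (1 - \<eta>)) Kmax)" if "0 < \<eta>" "\<eta> < 1" for \<eta>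
    using grid[of "1 / (1 - \<eta>)"] that by simp
  ultimately show ?thesis
    using opt_size_pos_scale opt_le_grid[OF _ _ assms(2)] grid[of 2]
    by (auto simp: dyadic_grid_eq_ratio_grid)
qed

end
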